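(* Let $\lambda>0$ and $\mu\in\mathbb{C}$, and suppose that either (a) $|1-\mu|<\lambda\le 1/2$, or (b) $\lambda\in(1/2,1]$ and $|1-\mu|\le 1-\lambda$. Let $f$ be meromorphic in $\mathbb{D}$ with $f(0)=f'(0)-1=0$ and $f\in\mathcal{U}(\lambda,\mu)$. Then $f$ is univalent in $\mathbb{D}$.
   Context: $\mathbb{D}=\{z\in\mathbb{C}:|z|<1\}$. For $\lambda>0$ and $\mu\in\mathbb{C}$ with $|1-\mu|<\lambda$, $\mathcal{U}(\lambda,\mu)$ denotes the family of all functions $f$ meromorphic in $\mathbb{D}$, normalized by $f(0)=f'(0)-1=0$, such that $|U_f(z)-\mu|<\lambda$ for all $z\in\mathbb{D}$, where $$U_f(z)=\left(\frac{z}{f(z)}\right)^2 f'(z)=\frac{z}{f(z)}-z\left(\frac{z}{f(z)}\right)',$$ understood with removable singularities removed (at $z=0$, where $z/f(z)$ takes the value $1$, and at the poles of $f$, where $z/f(z)$ takes the value $0$). A meromorphic function in $\mathbb{D}$ is univalent if it is injective as a map from $\mathbb{D}$ into the Riemann sphere $\mathbb{C}\cup\{\infty\}$. *)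

theory Defs
  imports "HOL-Complex_Analysis.Complex_Analysis"
begin

(* A meromorphic function on the disk is a function that is nicely_meromorphic_on it: off its poles
   it is continuous (hence analytic), and at its poles the stored value is the dummy 0.  The value
   in the Riemann sphere is recovered by sphere_value, with None playing the role of infinity. *)

definition sphere_value :: "(complex \<Rightarrow> complex) \<Rightarrow> complex \<Rightarrow> complex option" where
  "sphere_value f z = (if is_pole f z then None else Some (f z))"

definition univalent_on :: "(complex \<Rightarrow> complex) \<Rightarrow> complex set \<Rightarrow> bool" where
  "univalent_on f A \<longleftrightarrow> inj_on (sphere_value f) A"

(* remove_sings replaces the value at each removable singularity, in particular at 0 and at the
   poles of f, by the limit there. *)

definition U_op :: "(complex \<Rightarrow> complex) \<Rightarrow> complex \<Rightarrow> complex" where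
  "U_op f = remove_sings (\<lambda>z. (z / f z)\<^sup>2 * deriv f z)"

(* The derivative condition at 0 is stated with has_field_derivative, so that 0 is not a pole of f.
   At a zero of f other than 0 the expression above has a pole, where remove_sings returns the
   dummy value 0; the bound then fails at nearby points, so such f are excluded, as they should
   be. *)

definition U_class :: "real \<Rightarrow> complex \<Rightarrow> (complex \<Rightarrow> complex) set" where
  "U_class lam mu = {f. f nicely_meromorphic_on ball 0 1 \<and>
     f 0 = 0 \<and> (f has_field_derivative 1) (at 0) \<and>
     (\<forall>z\<in>ball 0 1. norm (U_op f z - mu) < lam)}"

end

theory Submission
  imports Defs
begin

text \<open>
  Write \<open>1 / f z = 1 / z + p z\<close> with \<open>p\<close> holomorphic in the disk. Then \<open>U\<^sub>f = 1 - z\<^sup>2 p'\<close>, so \<open>U\<^sub>f - \<mu>\<close>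
  takes the value \<open>1 - \<mu>\<close> at the origin to second order, and the Schwarz-Pick argument yields
  \<open>\<bar>p'\<bar> \<le> \<lambda> + \<bar>1 - \<mu>\<bar> \<le> 1\<close>. Hence \<open>p\<close> is 1-Lipschitz, whereas a coincidence \<open>f z = f w\<close> with \<open>z \<noteq> w\<close>
  would force \<open>\<bar>p z - p w\<bar> = \<bar>z - w\<bar> / \<bar>z w\<bar> > \<bar>z - w\<bar>\<close>.
\<close>

section \<open>A Schwarz-Pick estimate for functions taking a value to second order\<close>

lemma norm_le_of_norm_power_mult_le:
  fixes q :: "complex \<Rightarrow> complex"
  assumes holo: "q holomorphic_on ball 0 1"
    and bound: "\<And>z. z \<in> ball 0 1 \<Longrightarrow> norm (z ^ n * q z) \<le> B"
    and z: "z \<in> ball 0 1"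
  shows "norm (q z) \<le> B"
proof -
  \<comment> \<open>The maximum modulus principle on the circle of radius \<open>r\<close> costs a
    factor \<open>1 / r ^ n\<close>, which disappears when \<open>r\<close> tends to 1
    below.\<close>
  have *: "norm (q z) * r ^ n \<le> B" if r: "norm z < r" "r < 1" for r
  proof -
    have "r > 0"
      using r(1) norm_ge_zero[of z] by linarith
    have sub: "cball 0 r \<subseteq> ball (0::complex) 1"
      using r by auto
    have "norm (q z) \<le> B / r ^ n"
    proof (rule maximum_modulus_frontier[where S = "ball 0 r" and f = q])
      show "q holomorphic_on interior (ball 0 r)"
        using holomorphic_on_subset[OF holo] r(2) by (simp add: subset_ball)
      show "continuous_on (closure (ball 0 r)) q"
        using holomorphic_on_imp_continuous_on[OF holomorphic_on_subset[OF holo sub]] \<open>r > 0\<close>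
        by simp
      show "norm (q w) \<le> B / r ^ n" if "w \<in> frontier (ball 0 r)" for w
      proof -
        have "norm w = r"
          using that \<open>r > 0\<close> by (simp add: frontier_ball)
        then show ?thesis
          using bound[of w] r \<open>r > 0\<close> by (simp add: norm_mult norm_power field_simps)
      qed
    qed (use r in auto)
    then show ?thesis
      using \<open>r > 0\<close> by (simp add: field_simps)
  qed
  have "((\<lambda>r. norm (q z) * r ^ n) \<longlongrightarrow> norm (q z) * 1 ^ n) (at_left 1)"
    by (intro tendsto_intros)
  moreover have "\<forall>\<^sub>F r in at_left 1. norm (q z) * r ^ n \<le> B"
    using eventually_at_left_real[of "norm z" 1] z *
    by (auto elim!: eventually_mono)
  ultimately have "norm (q z) * 1 ^ n \<le> B"
    by (rule tendsto_upperbound) simp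
  then show ?thesis
    by simp
qed

text \<open>The difference of the squares of the two sides factors as
  \<open>(r\<^sup>2 - |u|\<^sup>2) * (r\<^sup>2 - |w|\<^sup>2)\<close>. This is the fact that the
  Moebius map \<open>T u = r * (u - w) / (r\<^sup>2 - cnj w * u)\<close> sends the closed disk of
  radius \<open>r\<close> into the closed unit disk, in a form free of division.\<close>

lemma norm_diff_le_norm_moebius_denominator:
  fixes u w :: complex
  assumes "norm u \<le> r" "norm w \<le> r"
  shows "r * norm (u - w) \<le> norm (of_real (r\<^sup>2) - cnj w * u)"
proof (rule power2_le_imp_le)
  have "(norm (of_real (r\<^sup>2) - cnj w * u))\<^sup>2 - (r * norm (u - w))\<^sup>2
      = (r\<^sup>2 - (norm u)\<^sup>2) * (r\<^sup>2 - (norm w)\<^sup>2)"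
    unfolding power_mult_distrib cmod_power2
    by (simp add: algebra_simps power2_eq_square)
  also have "\<dots> \<ge> 0"
    using assms by (intro mult_nonneg_nonneg) (simp_all add: power_mono)
  finally show "(r * norm (u - w))\<^sup>2 \<le> (norm (of_real (r\<^sup>2) - cnj w * u))\<^sup>2"
    by simp
qed simp

text \<open>With \<open>u z = w - z\<^sup>2 * q z\<close> and the Moebius map \<open>T\<close> that
  sends \<open>w\<close> to 0, \<open>T (u z)\<close> is bounded by 1 and vanishes to second order
  at 0. Dividing by \<open>z\<^sup>2\<close> keeps the bound and leaves, up to sign,
  \<open>r * q z / d z\<close>, where \<open>d\<close> is the denominator of \<open>T\<close>. Hence
  \<open>r * |q|\<close> is at most \<open>|d|\<close>, and the triangle inequality
  finishes.\<close>

lemma schwarz_pick_double_point: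
  fixes q :: "complex \<Rightarrow> complex"
  assumes holo: "q holomorphic_on ball 0 1"
    and w: "norm w < r"
    and bound: "\<And>z. z \<in> ball 0 1 \<Longrightarrow> norm (w - z\<^sup>2 * q z) \<le> r"
    and z: "z \<in> ball 0 1"
  shows "norm (q z) \<le> r + norm w"
proof -
  define u where "u z = w - z\<^sup>2 * q z" for z
  define d where "d z = of_real (r\<^sup>2) - cnj w * u z" for z
  have "r > 0"
    using w norm_ge_zero[of w] by linarith
  have wu: "norm (cnj w * u z) \<le> norm w * r" if "z \<in> ball 0 1" for z
    using bound[OF that] by (simp add: norm_mult u_def mult_left_mono)
  \<comment> \<open>Here the strict inequality \<open>norm w < r\<close> matters: the subtracted
    term has norm at most \<open>norm w * r < r\<^sup>2\<close>.\<close>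
  have d_nz: "d z \<noteq> 0" if "z \<in> ball 0 1" for z
  proof
    assume "d z = 0"
    then have "norm (cnj w * u z) = r\<^sup>2"
      unfolding d_def by (metis eq_iff_diff_eq_0 norm_of_real abs_power2)
    moreover have "norm w * r < r\<^sup>2"
      using w \<open>r > 0\<close> by (simp add: power2_eq_square)
    ultimately show False
      using wu[OF that] by linarith
  qed
  have "norm (of_real r * q z / d z) \<le> 1"
  proof (rule norm_le_of_norm_power_mult_le[where n = 2 and q = "\<lambda>z. of_real r * q z / d z"])
    show "(\<lambda>z. of_real r * q z / d z) holomorphic_on ball 0 1"
      using d_nz unfolding d_def u_def by (intro holomorphic_intros holo) auto
    show "norm (z\<^sup>2 * (of_real r * q z / d z)) \<le> 1" if "z \<in> ball 0 1" for z
    proof -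
      have "r * norm (u z - w) \<le> norm (d z)"
        unfolding d_def
        using bound[OF that] w by (intro norm_diff_le_norm_moebius_denominator) (auto simp: u_def)
      then show ?thesis
        using d_nz[OF that] \<open>r > 0\<close>
        by (simp add: u_def norm_mult norm_divide norm_power field_simps)
    qed
  qed fact
  then have "r * norm (q z) \<le> norm (d z)"
    using d_nz[OF z] \<open>r > 0\<close> by (simp add: norm_mult norm_divide field_simps)
  also have "norm (d z) \<le> norm (of_real (r\<^sup>2) :: complex) + norm (cnj w * u z)"
    unfolding d_def by (rule norm_triangle_ineq4)
  also have "\<dots> \<le> r\<^sup>2 + norm w * r"
    using wu[OF z] by (simp add: norm_power)
  also have "\<dots> = r * (r + norm w)"
    by (simp add: power2_eq_square algebra_simps)
  finally show ?thesis
    using \<open>r > 0\<close> by simp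
qed

section \<open>The regular part of \<open>1 / f\<close>\<close>

lemma inverse_diff_inverse_extends_holomorphic:
  fixes f :: "complex \<Rightarrow> complex"
  assumes "open S" "0 \<in> S"
    and holo: "(\<lambda>z. inverse (f z)) holomorphic_on S - {0}"
    and f0: "f 0 = 0" and df: "(f has_field_derivative 1) (at 0)"
  obtains p where "p holomorphic_on S" "\<And>z. z \<in> S - {0} \<Longrightarrow> p z = inverse (f z) - inverse z"
proof -
  \<comment> \<open>\<open>R\<close> is \<open>z / f z\<close> with its limit 1 filled in at the
    origin, so it is holomorphic there. The required \<open>p\<close> is its difference quotient at
    0, since \<open>(R z - 1) / z = 1 / f z - 1 / z\<close>.\<close>
  define R where "R z = (if z = 0 then 1 else z * inverse (f z))" for z
  have "(\<lambda>z. z * inverse (f z)) \<midarrow>0\<rightarrow> 1"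
  proof -
    have "(\<lambda>z. f z / z) \<midarrow>0\<rightarrow> 1"
      using df f0 by (simp add: has_field_derivative_iff)
    then have "(\<lambda>z. inverse (f z / z)) \<midarrow>0\<rightarrow> inverse 1"
      by (rule tendsto_inverse) simp
    then show ?thesis
      by (simp add: field_simps)
  qed
  then have lim0: "R \<midarrow>0\<rightarrow> 1"
    by (rule Lim_transform_eventually) (auto simp: R_def eventually_at_filter)
  have "(\<lambda>z. z * inverse (f z)) holomorphic_on S - {0}"
    by (intro holomorphic_intros holo)
  then have "R holomorphic_on S - {0}"
    by (rule holomorphic_transform) (auto simp: R_def)
  then have "R holomorphic_on S"
    using \<open>open S\<close> lim0
    by (intro no_isolated_singularity'[of "{0}" R S]) (auto simp: R_def intro: tendsto_within_subset)
  moreover have "0 \<in> interior S"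
    using assms by (simp add: interior_open)
  ultimately have "(\<lambda>z. if z = 0 then deriv R 0 else (R z - R 0) / (z - 0)) holomorphic_on S"
    by (rule pole_lemma)
  then show thesis
    by (rule that) (auto simp: R_def field_simps)
qed

lemma U_op_eq:
  assumes "f analytic_on {z}" "f z \<noteq> 0"
  shows "U_op f z = (z / f z)\<^sup>2 * deriv f z"
  unfolding U_op_def using assms
  by (intro remove_sings_at_analytic analytic_intros) auto

lemma deriv_inverse_eq_U_op:
  assumes "f analytic_on {z}" "f z \<noteq> 0" "z \<noteq> 0"
  shows "deriv (\<lambda>z. inverse (f z)) z = - U_op f z / z\<^sup>2"
proof -
  have "(f has_field_derivative deriv f z) (at z)"
    using assms(1) by (simp add: analytic_on_imp_differentiable_at field_differentiable_derivI)
  then have "((\<lambda>z. inverse (f z)) has_field_derivative - (inverse (f z) * deriv f z * inverse (f z))) (at z)"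
    using assms by (intro DERIV_inverse')
  then show ?thesis
    using assms by (simp add: U_op_eq DERIV_imp_deriv power2_eq_square field_simps)
qed

text \<open>Since \<open>z\<^sup>2 * (1 / f)' = - U_op f z\<close>, a zero of \<open>f\<close> off
  the origin, being a pole of \<open>1 / f\<close>, would make \<open>U_op f\<close> unbounded.
  Poles of \<open>f\<close> are only zeros of \<open>1 / f\<close>, so \<open>1 / f\<close> is
  holomorphic off the origin.\<close>

lemma U_class_regular_part:
  assumes f: "f \<in> U_class lam mu"
  obtains p where "p holomorphic_on ball 0 1"
    "\<And>z. z \<in> ball 0 1 - {0} \<Longrightarrow> p z = inverse (f z) - inverse z"
    "\<And>z. z \<in> ball 0 1 \<Longrightarrow> norm (1 - mu - z\<^sup>2 * deriv p z) \<le> lam"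
    "\<And>z. z \<in> ball 0 1 - {0} \<Longrightarrow> \<not> is_pole f z \<Longrightarrow> f z \<noteq> 0"
proof -
  define D where "D = ball (0::complex) 1"
  define h where "h z = inverse (f z)" for z
  have D: "open D" "connected D" "0 \<in> D"
    by (auto simp: D_def)
  have mero: "f nicely_meromorphic_on D"
    and f0: "f 0 = 0" and df: "(f has_field_derivative 1) (at 0)"
    and bound: "\<And>z. z \<in> D \<Longrightarrow> norm (U_op f z - mu) < lam"
    using f by (auto simp: U_class_def D_def)
  \<comment> \<open>The dummy values agree with \<open>inverse 0 = 0\<close>: at a pole of
    \<open>f\<close> this is the true value of \<open>1 / f\<close>, and at an isolated zero of
    \<open>f\<close> it is the dummy value at a pole.\<close>
  have mero_h: "h nicely_meromorphic_on D"
    unfolding h_def by (intro nicely_meromorphic_on_inverse mero)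
  have "\<not> (\<forall>z\<in>D. f z = 0)"
  proof
    assume zero: "\<forall>z\<in>D. f z = 0"
    have "(f has_field_derivative 0) (at 0)"
      by (rule has_field_derivative_transform_within_open[of "\<lambda>_. 0" 0 0 D])
        (use zero D in auto)
    with df show False
      using DERIV_unique by fastforce
  qed
  then have nonzero: "\<forall>\<^sub>F w in at z. f w \<noteq> 0" if "z \<in> D" for z
    using nicely_meromorphic_imp_constant_or_avoid[OF mero D(1,2), of 0] that D
    by (auto simp: eventually_cosparse_open_eq)
  \<comment> \<open>The explicit formula for \<open>U_op\<close> is used only at such points. They
    fill a punctured neighbourhood of every point, which suffices for the limit arguments
    below.\<close>
  have regular: "\<forall>\<^sub>F w in at z. w \<in> D - {0} \<and> f analytic_on {w} \<and> f w \<noteq> 0" if "z \<in> D" for z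
  proof -
    have "\<forall>\<^sub>F w in at z. w \<in> D"
      using D that by (simp add: eventually_at_in_open')
    moreover have "\<forall>\<^sub>F w in at z. w \<noteq> 0"
      using eventually_neq_at_within[of 0] by blast
    moreover have "\<forall>\<^sub>F w in at z. f analytic_on {w}"
      using mero meromorphic_on_imp_analytic_cosparse[of f D] that D
      by (auto simp: nicely_meromorphic_on_def eventually_cosparse_open_eq)
    ultimately show ?thesis
      using nonzero[OF that] by eventually_elim auto
  qed
  \<comment> \<open>A pole of \<open>h\<close> is also one of \<open>deriv h\<close>, and the factor
    \<open>w\<^sup>2\<close> does not vanish at \<open>z\<close>; but
    \<open>w\<^sup>2 * deriv h w\<close> is bounded by \<open>norm mu + lam\<close> near
    \<open>z\<close>.\<close>
  have no_pole: "\<not> is_pole h z" if z: "z \<in> D - {0}" for z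
  proof
    from z have z': "z \<in> D"
      by blast
    assume "is_pole h z"
    then have "is_pole (deriv h) z"
      using mero_h z is_pole_deriv_iff[of h z] meromorphic_on_subset[of h D "{z}"]
      by (auto simp: nicely_meromorphic_on_def)
    then have "is_pole (\<lambda>w. w\<^sup>2 * deriv h w) z"
      using z by (intro is_pole_mult_analytic_nonzero1 analytic_intros) auto
    then have inf: "filterlim (\<lambda>w. norm (w\<^sup>2 * deriv h w)) at_top (at z)"
      unfolding is_pole_def by (rule filterlim_at_infinity_imp_norm_at_top)
    have "\<forall>\<^sub>F w in at z. norm (w\<^sup>2 * deriv h w) \<le> norm mu + lam"
      using regular[OF z']
    proof eventually_elim
      case (elim w)
      then have "norm (w\<^sup>2 * deriv h w) = norm (U_op f w)"
        unfolding h_def by (simp add: deriv_inverse_eq_U_op)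
      also have "\<dots> \<le> norm mu + norm (U_op f w - mu)"
        by (metis add_diff_cancel_left' diff_add_cancel norm_triangle_ineq add.commute)
      finally show ?case
        using bound[of w] elim by auto
    qed
    moreover have "\<forall>\<^sub>F w in at z. norm (w\<^sup>2 * deriv h w) > norm mu + lam"
      using inf by (simp add: filterlim_at_top_dense)
    ultimately have "\<forall>\<^sub>F w in at z. False"
      by eventually_elim auto
    then show False
      by simp
  qed
  have "h analytic_on D - {0}"
    using mero_h no_pole nicely_meromorphic_on_subset[of h D "D - {0}"]
    by (intro nicely_meromorphic_without_singularities) auto
  then have "h holomorphic_on D - {0}"
    by (rule analytic_imp_holomorphic)
  then obtain p where holo: "p holomorphic_on D"
    and p: "\<And>z. z \<in> D - {0} \<Longrightarrow> p z = h z - inverse z"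
    using inverse_diff_inverse_extends_holomorphic[of D f] D f0 df unfolding h_def by blast
  \<comment> \<open>At regular points the expression equals \<open>U_op f w - mu\<close>; continuity
    of \<open>deriv p\<close> carries the bound, no longer strict, to the origin and the poles of
    \<open>f\<close>.\<close>
  have "norm (1 - mu - z\<^sup>2 * deriv p z) \<le> lam" if z: "z \<in> D" for z
  proof (rule tendsto_upperbound)
    have "deriv p holomorphic_on D"
      using holo D by (intro holomorphic_deriv)
    then have "deriv p \<midarrow>z\<rightarrow> deriv p z"
      using D z by (metis continuous_on_eq_continuous_at holomorphic_on_imp_continuous_on isContD)
    then show "(\<lambda>w. norm (1 - mu - w\<^sup>2 * deriv p w)) \<midarrow>z\<rightarrow> norm (1 - mu - z\<^sup>2 * deriv p z)"
      by (intro tendsto_intros)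
    show "\<forall>\<^sub>F w in at z. norm (1 - mu - w\<^sup>2 * deriv p w) \<le> lam"
      using regular[OF z]
    proof eventually_elim
      case (elim w)
      have "(h has_field_derivative deriv h w) (at w)"
        unfolding h_def using elim
        by (intro field_differentiable_derivI analytic_on_imp_differentiable_at analytic_intros) auto
      then have "((\<lambda>w. h w - inverse w) has_field_derivative deriv h w + inverse (w\<^sup>2)) (at w)"
        using elim by (auto intro!: derivative_eq_intros simp: power2_eq_square)
      then have "(p has_field_derivative deriv h w + inverse (w\<^sup>2)) (at w)"
        by (rule has_field_derivative_transform_within_open[of _ _ _ "D - {0}"])
          (use elim D p in auto)
      then have "deriv p w = deriv h w + inverse (w\<^sup>2)"
        by (rule DERIV_imp_deriv)
      moreover have "deriv h w = - U_op f w / w\<^sup>2"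
        unfolding h_def using elim by (intro deriv_inverse_eq_U_op) auto
      ultimately have "1 - mu - w\<^sup>2 * deriv p w = U_op f w - mu"
        using elim by (simp add: field_simps)
      then show ?case
        using bound[of w] elim by (metis DiffD1 less_imp_le)
    qed
  qed simp
  \<comment> \<open>A stored value 0 marks either a pole of \<open>f\<close> or an isolated zero,
    and the latter would be a pole of \<open>h\<close>.\<close>
  moreover have "f z \<noteq> 0" if "z \<in> D - {0}" "\<not> is_pole f z" for z
    using zero_or_pole[OF mero _ _ nonzero] no_pole[of z] that
    by (auto simp: h_def[abs_def] is_pole_inverse_iff)
  ultimately show thesis
    using that[of p] holo p unfolding D_def h_def by blast
qed

section \<open>Univalence\<close>

theorem theorem2:
  fixes lam :: real and mu :: complex and f :: "complex \<Rightarrow> complex"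
  assumes "lam > 0"
    and "(norm (1 - mu) < lam \<and> lam \<le> 1/2) \<or>
         (lam \<in> {1/2<..1} \<and> norm (1 - mu) \<le> 1 - lam)"
    and "f \<in> U_class lam mu"
  shows "univalent_on f (ball 0 1)"
proof -
  \<comment> \<open>In the first case the sum is below \<open>2 * lam \<le> 1\<close>; in the
    second, \<open>1 - lam < lam\<close> because \<open>lam > 1/2\<close>.\<close>
  have mu: "norm (1 - mu) < lam" "lam + norm (1 - mu) \<le> 1"
    using assms(2) by auto
  obtain p where holo: "p holomorphic_on ball 0 1"
    and p: "\<And>z. z \<in> ball 0 1 - {0} \<Longrightarrow> p z = inverse (f z) - inverse z"
    and bound: "\<And>z. z \<in> ball 0 1 \<Longrightarrow> norm (1 - mu - z\<^sup>2 * deriv p z) \<le> lam"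
    and nonzero: "\<And>z. z \<in> ball 0 1 - {0} \<Longrightarrow> \<not> is_pole f z \<Longrightarrow> f z \<noteq> 0"
    using U_class_regular_part[OF assms(3)] by blast
  have "norm (deriv p z) \<le> 1" if "z \<in> ball 0 1" for z
    using schwarz_pick_double_point[of "deriv p" "1 - mu" lam z] holo mu bound that
    by (force intro: holomorphic_deriv)
  then have lipschitz: "norm (p z - p w) \<le> norm (z - w)" if "z \<in> ball 0 1" "w \<in> ball 0 1" for z w
    using field_differentiable_bound[of "ball 0 1" p "deriv p" 1 z w] that
      holomorphic_derivI[OF holo open_ball] by auto
  \<comment> \<open>Working with \<open>inverse (f z)\<close> treats infinity like any other value:
    at a pole it is 0, so two distinct poles are excluded as well.\<close>
  have inverse_inj: "z = w"
    if z: "z \<in> ball 0 1 - {0}" and w: "w \<in> ball 0 1 - {0}" and eq: "inverse (f z) = inverse (f w)"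
    for z w
  proof (rule ccontr)
    assume "z \<noteq> w"
    have "p z - p w = inverse w - inverse z"
      using p[OF z] p[OF w] eq by simp
    also have "\<dots> = (z - w) / (z * w)"
      using z w by (simp add: field_simps)
    finally have "norm (p z - p w) = norm ((z - w) / (z * w))"
      by simp
    then have "norm (z - w) / (norm z * norm w) \<le> norm (z - w)"
      using lipschitz[of z w] z w by (simp add: norm_divide norm_mult)
    then have "norm z * norm w \<ge> 1"
      using \<open>z \<noteq> w\<close> z w by (simp add: field_simps)
    moreover have "norm z * norm w < 1 * 1"
      using z w by (intro mult_strict_mono) auto
    ultimately show False
      by simp
  qed
  have mero: "f nicely_meromorphic_on ball 0 1"
    and f0: "f 0 = 0" and df: "(f has_field_derivative 1) (at 0)"
    using assms(3) by (auto simp: U_class_def)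
  have no_pole_0: "\<not> is_pole f 0"
    using DERIV_isCont[OF df] not_tendsto_and_filterlim_at_infinity[of "at 0" f]
    by (auto simp: is_pole_def isCont_def)
  have pole_zero: "f z = 0" if "z \<in> ball 0 1" "is_pole f z" for z
    using is_pole_zero_at_nicely_mero[OF mero] that by blast
  show ?thesis
    unfolding univalent_on_def
  proof (rule inj_onI)
    fix z w :: complex
    assume z: "z \<in> ball 0 1" and w: "w \<in> ball 0 1"
      and "sphere_value f z = sphere_value f w"
    then have eq: "is_pole f z \<longleftrightarrow> is_pole f w" "f z = f w"
      using pole_zero by (auto simp: sphere_value_def split: if_splits)
    show "z = w"
    \<comment> \<open>The origin is handled separately because \<open>1 / f\<close> has its pole
      there: 0 is not a pole of \<open>f\<close>, so the other point is not one either, and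
      \<open>nonzero\<close> forces it to be 0.\<close>
    proof (cases "z = 0 \<or> w = 0")
      case True
      then show ?thesis
        using eq z w f0 no_pole_0 nonzero[of z] nonzero[of w] by (metis Diff_iff singletonD)
    next
      case False
      then show ?thesis
        using inverse_inj z w eq by auto
    qed
  qed
qed

end
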